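(* Let $\Gamma$ be a simple $G$-bi-transitive $2$-colored graph. Suppose that black vertices of $\Gamma$ have valency $k$ while white vertices have valency $4$, and that there exists a white vertex $v$ of $\Gamma$ such that $G_v^{\Gamma(v)}$ is imprimitive. Let $\Delta(v)$ be an imprimitivity system of $G_v^{\Gamma(v)}$. Then $\Gamma\cong\mathrm{BGCG}(X,M)$, where $X$ is a $k$-valent (not necessarily simple) $G$-dart-transitive graph (with $G$ acting as a group of symmetries of $X$) and $M$ is a $G$-invariant separating relation for $X$ such that each $M$-equivalence class has cardinality $2$. In fact, $X$ and $M$ can be chosen to be $\mathrm{Dis}(\Gamma,\Delta)$ and $\mathrm{Mate}(\Gamma,\Delta)$, respectively, where $\Delta=\mathrm{Pairs}(\Gamma,G,\Delta(v))$.
   Context: Graphs. A graph is a triple $(V,E,\partial)$ with $V$ (vertices) and $E$ (edges) finite sets and $\partial$ a map from $E$ to the set of $2$-element subsets of $V$; the elements of $\partial(e)$ are the endvertices of $e$. Parallel edges are allowed; the graph is simple if $\partial$ is injective. Two edges are adjacent if they share an endvertex. The neighbourhood $\Gamma(v)$ of a vertex $v$ is the set of edges having $v$ as an endvertex, and the valency of $v$ is $|\Gamma(v)|$; a graph is $k$-valent if all vertices have valency $k$. A dart is a pair $(e,v)$ with $e$ an edge and $v\in\partial(e)$. Symmetries. A symmetry of a graph is a permutation $g$ of $V\cup E$ preserving $V$ and $E$ with $\partial(e^g)=\partial(e)^g$ for all edges $e$; the symmetries form the group $\mathrm{Aut}$ (acting on the right). A graph is $G$-dart-transitive if the group $G$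 of symmetries is transitive on darts. A $2$-colored graph is a graph with a proper coloring of its vertices in black and white. A $2$-colored graph $\Gamma$ is $G$-bi-transitive if $G\le\mathrm{Aut}(\Gamma)$ is a group of color-preserving symmetries that is transitive on edges. $G_v$ is the stabilizer of $v$ in $G$, and $G_v^{\Gamma(v)}$ is the permutation group induced by $G_v$ on $\Gamma(v)$. An imprimitivity system is a nontrivial invariant partition; for $G_v^{\Gamma(v)}$ of degree $4$ it consists of two blocks of size $2$. Separating relation and split. A separating relation for a graph $X$ is an equivalence relation $M$ on the edge set of $X$ such that no two (distinct) adjacent edges of $X$ are $M$-related. A split at white vertices of a $2$-colored graph $\Gamma$ is a partition of the edge set of $\Gamma$ such that each part consists of exactly two edges and these two edges have a white endvertex in common. $\mathrm{Pairs}$. For each white vertex $w$ of $\Gamma$ choose $g_w\in G$ with $v^{g_w}=w$ and put $\Delta(w)=\Delta(v)^{g_w}=\{D^{g_w}: D\in\Delta(v)\}$, which does not depend on the choice of $g_w$. Then $\mathrm{Pairs}(\Gamma,G,\Delta(v))$ is the split at white vertices of $\Gamma$ in which two edges are in the same part if they have a common white endvertex $w$ and are in the same block of $\Delta(w)$. $\mathrm{Dis}$ and $\mathrm{Mate}$. Given a simple $2$-colored graph $\Gamma$ with no isolated white vertices and a split $\Delta$ at white vertices of $\Gamma$, the graph $\mathrm{Dis}(\Gamma,\Delta)$ has as vertices the black vertices of $\Gamma$, and for each part $\{e_1,e_2\}$ of $\Delta$ it has one edge whose endvertices are the black endvertex of $e_1$ and the black endvertex of $e_2$; this edge is said to arise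 from the common white endvertex of $e_1$ and $e_2$. $\mathrm{Mate}(\Gamma,\Delta)$ is the equivalence relation on the edges of $\mathrm{Dis}(\Gamma,\Delta)$ in which two edges are related if they arise from the same white vertex of $\Gamma$; it is a separating relation. BGCG. Given a graph $X$ and a separating relation $M$ for $X$, let $X^*$ be the subdivision of $X$: vertices of $X$ are black, each edge $e$ of $X$ is replaced by a new white vertex joined by one new edge to each of the two endvertices of $e$. Regard $M$ as an equivalence relation on the white vertices of $X^*$ (identified with the edges of $X$), and extend it to all vertices of $X^*$ by making each black vertex related only to itself. Then $\mathrm{BGCG}(X,M)$ is the quotient $X^*/M$: its vertices are the classes $[u]$, and each edge $e$ of $X^*$ with ends $u,v$ gives an edge $[e]$ with ends $[u],[v]$. It is a simple graph inheriting the black/white coloring of $X^*$. *)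

theory Defs
  imports "HOL-Algebra.Bij" "HOL-Library.Disjoint_Sets"
begin

section \<open>Graphs with parallel edges\<close>

record ('v, 'e) mgraph =
  verts :: "'v set"
  edges :: "'e set"
  ends :: "'e \<Rightarrow> 'v set"

definition is_graph :: "('v, 'e, 'x) mgraph_scheme \<Rightarrow> bool" where
  "is_graph X \<longleftrightarrow> finite (verts X) \<and> finite (edges X) \<and>
     (\<forall>e \<in> edges X. ends X e \<subseteq> verts X \<and> card (ends X e) = 2)"

definition simple :: "('v, 'e, 'x) mgraph_scheme \<Rightarrow> bool" where
  "simple X \<longleftrightarrow> inj_on (ends X) (edges X)"

definition adjacent :: "('v, 'e, 'x) mgraph_scheme \<Rightarrow> 'e \<Rightarrow> 'e \<Rightarrow> bool" where
  "adjacent X e f \<longleftrightarrow> ends X e \<inter> ends X f \<noteq> {}"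

definition nbhd :: "('v, 'e, 'x) mgraph_scheme \<Rightarrow> 'v \<Rightarrow> 'e set" where
  "nbhd X v = {e \<in> edges X. v \<in> ends X e}"

definition valency :: "('v, 'e, 'x) mgraph_scheme \<Rightarrow> 'v \<Rightarrow> nat" where
  "valency X v = card (nbhd X v)"

definition valent :: "nat \<Rightarrow> ('v, 'e, 'x) mgraph_scheme \<Rightarrow> bool" where
  "valent k X \<longleftrightarrow> (\<forall>v \<in> verts X. valency X v = k)"

definition darts :: "('v, 'e, 'x) mgraph_scheme \<Rightarrow> ('e \<times> 'v) set" where
  "darts X = {(e, v). e \<in> edges X \<and> v \<in> ends X e}"


section \<open>Symmetries\<close>

text \<open>The set \<open>V \<union> E\<close> is the disjoint sum \<open>V <+> E\<close>. Permutations of it are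
  the elements of \<^const>\<open>Bij\<close>, so they are extensional functions. The group operation
  of \<^const>\<open>BijGroup\<close> is composition of functions written on the left; a group of
  permutations acting on the right is the opposite group, which has the same subgroups,
  orbits and homomorphisms.\<close>

definition vact :: "('v + 'e \<Rightarrow> 'v + 'e) \<Rightarrow> 'v \<Rightarrow> 'v" where
  "vact g u = projl (g (Inl u))"

definition eact :: "('v + 'e \<Rightarrow> 'v + 'e) \<Rightarrow> 'e \<Rightarrow> 'e" where
  "eact g e = projr (g (Inr e))"

definition symmetry :: "('v, 'e, 'x) mgraph_scheme \<Rightarrow> ('v + 'e \<Rightarrow> 'v + 'e) \<Rightarrow> bool" where
  "symmetry X g \<longleftrightarrow> g \<in> Bij (verts X <+> edges X) \<and>
     g ` Inl ` verts X = Inl ` verts X \<and> g ` Inr ` edges X = Inr ` edges X \<and>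
     (\<forall>e \<in> edges X. ends X (eact g e) = vact g ` ends X e)"

definition aut :: "('v, 'e, 'x) mgraph_scheme \<Rightarrow> ('v + 'e \<Rightarrow> 'v + 'e) monoid" where
  "aut X = (BijGroup (verts X <+> edges X))\<lparr>carrier := {g. symmetry X g}\<rparr>"

definition dart_transitive ::
    "('v + 'e \<Rightarrow> 'v + 'e) set \<Rightarrow> ('v, 'e, 'x) mgraph_scheme \<Rightarrow> bool" where
  "dart_transitive H X \<longleftrightarrow> subgroup H (aut X) \<and>
     (\<forall>(e, u) \<in> darts X. \<forall>(f, w) \<in> darts X. \<exists>g \<in> H. eact g e = f \<and> vact g u = w)"

definition vertex_stabilizer :: "('v + 'e \<Rightarrow> 'v + 'e) set \<Rightarrow> 'v \<Rightarrow> ('v + 'e \<Rightarrow> 'v + 'e) set" where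
  "vertex_stabilizer G v = {g \<in> G. vact g v = v}"

text \<open>The permutation group \<open>G\<^sub>v\<^sup>\<Gamma>\<^sup>(\<^sup>v\<^sup>)\<close> induced on the neighbourhood of \<open>v\<close>.\<close>

definition local_group ::
    "('v, 'e, 'x) mgraph_scheme \<Rightarrow> ('v + 'e \<Rightarrow> 'v + 'e) set \<Rightarrow> 'v \<Rightarrow> ('e \<Rightarrow> 'e) set" where
  "local_group X G v = (\<lambda>g. restrict (eact g) (nbhd X v)) ` vertex_stabilizer G v"

definition imprimitivity_system :: "('a \<Rightarrow> 'a) set \<Rightarrow> 'a set \<Rightarrow> 'a set set \<Rightarrow> bool" where
  "imprimitivity_system H \<Omega> P \<longleftrightarrow> partition_on \<Omega> P \<and>
     P \<noteq> {\<Omega>} \<and> P \<noteq> (\<lambda>x. {x}) ` \<Omega> \<and>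
     (\<forall>h \<in> H. \<forall>D \<in> P. h ` D \<in> P)"

definition imprimitive :: "('a \<Rightarrow> 'a) set \<Rightarrow> 'a set \<Rightarrow> bool" where
  "imprimitive H \<Omega> \<longleftrightarrow> (\<exists>P. imprimitivity_system H \<Omega> P)"


section \<open>2-colored graphs\<close>

datatype colour = Black | White

record ('v, 'e) cgraph = "('v, 'e) mgraph" +
  col :: "'v \<Rightarrow> colour"

definition is_colored_graph :: "('v, 'e) cgraph \<Rightarrow> bool" where
  "is_colored_graph Y \<longleftrightarrow> is_graph Y \<and>
     (\<forall>e \<in> edges Y. \<forall>u \<in> ends Y e. \<forall>w \<in> ends Y e. u \<noteq> w \<longrightarrow> col Y u \<noteq> col Y w)"

definition color_preserving :: "('v, 'e) cgraph \<Rightarrow> ('v + 'e \<Rightarrow> 'v + 'e) \<Rightarrow> bool" where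
  "color_preserving Y g \<longleftrightarrow> (\<forall>u \<in> verts Y. col Y (vact g u) = col Y u)"

definition bi_transitive :: "('v + 'e \<Rightarrow> 'v + 'e) set \<Rightarrow> ('v, 'e) cgraph \<Rightarrow> bool" where
  "bi_transitive G Y \<longleftrightarrow> subgroup G (aut Y) \<and> (\<forall>g \<in> G. color_preserving Y g) \<and>
     (\<forall>e \<in> edges Y. \<forall>f \<in> edges Y. \<exists>g \<in> G. eact g e = f)"

definition colored_isomorphic :: "('v, 'e) cgraph \<Rightarrow> ('w, 'f) cgraph \<Rightarrow> bool" where
  "colored_isomorphic Y Z \<longleftrightarrow> (\<exists>f h. bij_betw f (verts Y) (verts Z) \<and>
     bij_betw h (edges Y) (edges Z) \<and>
     (\<forall>e \<in> edges Y. ends Z (h e) = f ` ends Y e) \<and>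
     (\<forall>u \<in> verts Y. col Z (f u) = col Y u))"


section \<open>The construction BGCG\<close>

definition separating_relation :: "('v, 'e, 'x) mgraph_scheme \<Rightarrow> 'e rel \<Rightarrow> bool" where
  "separating_relation X M \<longleftrightarrow> equiv (edges X) M \<and>
     (\<forall>(e, f) \<in> M. e \<noteq> f \<longrightarrow> \<not> adjacent X e f)"

text \<open>The white vertex of the subdivision that replaces the edge \<open>e\<close> is \<open>Inr e\<close>,
  and the new edge joining it to \<open>v\<close> is the dart \<open>(e, v)\<close>.\<close>

definition subdivision :: "('v, 'e, 'x) mgraph_scheme \<Rightarrow> ('v + 'e, 'e \<times> 'v) cgraph" where
  "subdivision X = \<lparr>verts = verts X <+> edges X, edges = darts X,
     ends = (\<lambda>(e, v). {Inr e, Inl v}),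
     col = case_sum (\<lambda>_. Black) (\<lambda>_. White)\<rparr>"

text \<open>Quotient of \<open>Y\<close> by an equivalence relation \<open>R\<close> on its vertices. The class \<open>[e]\<close>
  consists of the edges whose ends are, as an unordered pair, \<open>R\<close>-related to those of \<open>e\<close>,
  so its ends are \<open>[u]\<close> and \<open>[v]\<close> when \<open>u\<close> and \<open>v\<close> are those of any edge in it.\<close>

definition quotient_ends :: "('v, 'e) cgraph \<Rightarrow> 'v rel \<Rightarrow> 'e \<Rightarrow> 'v set set" where
  "quotient_ends Y R e = (\<lambda>u. R `` {u}) ` ends Y e"

definition quotient_edge :: "('v, 'e) cgraph \<Rightarrow> 'v rel \<Rightarrow> 'e \<Rightarrow> 'e set" where
  "quotient_edge Y R e = {f \<in> edges Y. quotient_ends Y R f = quotient_ends Y R e}"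

definition quotient_graph :: "('v, 'e) cgraph \<Rightarrow> 'v rel \<Rightarrow> ('v set, 'e set) cgraph" where
  "quotient_graph Y R = \<lparr>verts = verts Y // R,
     edges = quotient_edge Y R ` edges Y,
     ends = (\<lambda>C. \<Union>e \<in> C. quotient_ends Y R e),
     col = (\<lambda>U. the_elem (col Y ` U))\<rparr>"

definition extend_relation :: "('v, 'e, 'x) mgraph_scheme \<Rightarrow> 'e rel \<Rightarrow> ('v + 'e) rel" where
  "extend_relation X M = {(Inl u, Inl u) |u. u \<in> verts X} \<union> {(Inr e, Inr f) |e f. (e, f) \<in> M}"

definition BGCG ::
    "('v, 'e, 'x) mgraph_scheme \<Rightarrow> 'e rel \<Rightarrow> (('v + 'e) set, ('e \<times> 'v) set) cgraph" where
  "BGCG X M = quotient_graph (subdivision X) (extend_relation X M)"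


section \<open>The constructions Pairs, Dis and Mate\<close>

definition transporter ::
    "('v + 'e \<Rightarrow> 'v + 'e) set \<Rightarrow> 'v \<Rightarrow> 'v \<Rightarrow> 'v + 'e \<Rightarrow> 'v + 'e" where
  "transporter G v w = (SOME g. g \<in> G \<and> vact g v = w)"

definition transported_system ::
    "('v + 'e \<Rightarrow> 'v + 'e) set \<Rightarrow> 'v \<Rightarrow> 'e set set \<Rightarrow> 'v \<Rightarrow> 'e set set" where
  "transported_system G v D w = (\<lambda>B. eact (transporter G v w) ` B) ` D"

text \<open>A split, being a partition of the edges, is the set of its parts.\<close>

definition Pairs ::
    "('v, 'e) cgraph \<Rightarrow> ('v + 'e \<Rightarrow> 'v + 'e) set \<Rightarrow> 'v \<Rightarrow> 'e set set \<Rightarrow> 'e set set" where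
  "Pairs Y G v D = edges Y //
     {(e, f). e \<in> edges Y \<and> f \<in> edges Y \<and>
        (\<exists>w \<in> verts Y. col Y w = White \<and> w \<in> ends Y e \<and> w \<in> ends Y f \<and>
           (\<exists>B \<in> transported_system G v D w. e \<in> B \<and> f \<in> B))}"

text \<open>The edges of \<open>Dis Y S\<close> are the parts of \<open>S\<close> themselves.\<close>

definition Dis :: "('v, 'e) cgraph \<Rightarrow> 'e set set \<Rightarrow> ('v, 'e set) mgraph" where
  "Dis Y S = \<lparr>verts = {b \<in> verts Y. col Y b = Black}, edges = S,
     ends = (\<lambda>P. {b. col Y b = Black \<and> (\<exists>e \<in> P. b \<in> ends Y e)})\<rparr>"

definition arises_from :: "('v, 'e) cgraph \<Rightarrow> 'e set \<Rightarrow> 'v \<Rightarrow> bool" where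
  "arises_from Y P w \<longleftrightarrow> w \<in> verts Y \<and> col Y w = White \<and> (\<forall>e \<in> P. w \<in> ends Y e)"

definition Mate :: "('v, 'e) cgraph \<Rightarrow> 'e set set \<Rightarrow> ('e set) rel" where
  "Mate Y S = {(P, Q). P \<in> S \<and> Q \<in> S \<and> (\<exists>w. arises_from Y P w \<and> arises_from Y Q w)}"

text \<open>The permutation that a symmetry \<open>g\<close> of \<open>Y\<close> induces on the vertices and edges
  of \<open>Dis Y S\<close>.\<close>

definition Dis_action ::
    "('v, 'e) cgraph \<Rightarrow> 'e set set \<Rightarrow> ('v + 'e \<Rightarrow> 'v + 'e) \<Rightarrow> 'v + 'e set \<Rightarrow> 'v + 'e set" where
  "Dis_action Y S g = restrict (map_sum (vact g) (\<lambda>P. eact g ` P))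
     (verts (Dis Y S) <+> edges (Dis Y S))"


section \<open>Group actions by symmetries\<close>

text \<open>\<open>\<phi>\<close> is a faithful action of the group \<open>G\<close> of symmetries of \<open>Y\<close> by symmetries
  of \<open>X\<close>; it identifies \<open>G\<close> with the subgroup \<open>\<phi> ` G\<close> of \<open>aut X\<close>.\<close>

definition acts_as_symmetries ::
    "('v, 'e, 'x) mgraph_scheme \<Rightarrow> ('v + 'e \<Rightarrow> 'v + 'e) set \<Rightarrow>
     (('v + 'e \<Rightarrow> 'v + 'e) \<Rightarrow> 'w + 'f \<Rightarrow> 'w + 'f) \<Rightarrow> ('w, 'f, 'y) mgraph_scheme \<Rightarrow> bool" where
  "acts_as_symmetries Y G \<phi> X \<longleftrightarrow>
     \<phi> \<in> hom ((aut Y)\<lparr>carrier := G\<rparr>) (aut X) \<and> inj_on \<phi> G"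

definition invariant_relation :: "('v + 'e \<Rightarrow> 'v + 'e) set \<Rightarrow> 'e rel \<Rightarrow> bool" where
  "invariant_relation H M \<longleftrightarrow> (\<forall>h \<in> H. \<forall>(e, f) \<in> M. (eact h e, eact h f) \<in> M)"

definition BGCG_representation ::
    "('v, 'e) cgraph \<Rightarrow> ('v + 'e \<Rightarrow> 'v + 'e) set \<Rightarrow> nat \<Rightarrow>
     ('w, 'f) mgraph \<Rightarrow> 'f rel \<Rightarrow> (('v + 'e \<Rightarrow> 'v + 'e) \<Rightarrow> 'w + 'f \<Rightarrow> 'w + 'f) \<Rightarrow> bool" where
  "BGCG_representation Y G k X M \<phi> \<longleftrightarrow>
     is_graph X \<and> valent k X \<and>
     acts_as_symmetries Y G \<phi> X \<and> dart_transitive (\<phi> ` G) X \<and>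
     separating_relation X M \<and> invariant_relation (\<phi> ` G) M \<and>
     (\<forall>C \<in> edges X // M. card C = 2) \<and>
     colored_isomorphic Y (BGCG X M)"

end

theory Submission
  imports Defs
begin

text \<open>
  By edge transitivity \<open>G\<close> is transitive on white vertices and \<open>G\<^sub>v\<close> is transitive on the four
  edges at \<open>v\<close>, so the blocks have size 2 and their translates form a \<open>G\<close>-invariant split. For
  any split at white vertices in a simple 2-coloured graph, an edge \<open>e\<close> is determined by its black
  end and its part, which turns edges into darts of the derived graph; mated edges of the derived
  graph correspond to white vertices, so identifying them in the subdivision gives back the original
  graph. A symmetry fixing all black vertices and all parts fixes all white vertices, hence all
  edges by simplicity, so \<open>G\<close> acts faithfully on the derived graph.
\<close>

section \<open>Symmetries and the automorphism group\<close>

lemma Inl_in_Plus_iff [simp]: "Inl x \<in> A <+> B \<longleftrightarrow> x \<in> A"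
  and Inr_in_Plus_iff [simp]: "Inr y \<in> A <+> B \<longleftrightarrow> y \<in> B"
  by auto

text \<open>Elements of \<open>Bij\<close> are extensional, so off the disjoint sum \<open>g\<close>
  takes the default value of \<open>restrict\<close>. On it both summands are preserved, so the
  projections in \<open>vact\<close> and \<open>eact\<close> lose nothing. Thus a symmetry amounts
  to its two actions.\<close>

lemma symmetry_eq_map_sum:
  assumes "symmetry X g"
  shows "g = restrict (map_sum (vact g) (eact g)) (verts X <+> edges X)"
proof
  fix x
  have g: "g \<in> extensional (verts X <+> edges X)" "g ` Inl ` verts X = Inl ` verts X"
    "g ` Inr ` edges X = Inr ` edges X"
    using assms by (auto simp: symmetry_def Bij_def)
  show "g x = restrict (map_sum (vact g) (eact g)) (verts X <+> edges X) x"
  proof (cases "x \<in> verts X <+> edges X")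
    case True
    then show ?thesis
    proof
      fix u assume u: "u \<in> verts X" "x = Inl u"
      then have "g (Inl u) \<in> Inl ` verts X" using g(2) by (metis imageI)
      then have "g (Inl u) = Inl (vact g u)" by (elim imageE) (simp add: vact_def)
      then show ?thesis by (simp add: u)
    next
      fix e assume e: "e \<in> edges X" "x = Inr e"
      then have "g (Inr e) \<in> Inr ` edges X" using g(3) by (metis imageI)
      then have "g (Inr e) = Inr (eact g e)" by (elim imageE) (simp add: eact_def)
      then show ?thesis by (simp add: e)
    qed
  next
    case False
    then show ?thesis using extensional_arb[OF g(1) False] by simp
  qed
qed

lemma symmetry_Inl: "symmetry X g \<Longrightarrow> u \<in> verts X \<Longrightarrow> g (Inl u) = Inl (vact g u)"
  using fun_cong[OF symmetry_eq_map_sum, of X g "Inl u"] by simp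

lemma symmetry_Inr: "symmetry X g \<Longrightarrow> e \<in> edges X \<Longrightarrow> g (Inr e) = Inr (eact g e)"
  using fun_cong[OF symmetry_eq_map_sum, of X g "Inr e"] by simp

lemma symmetry_bij_vact:
  assumes "symmetry X g"
  shows "bij_betw (vact g) (verts X) (verts X)"
proof (rule bij_betwI')
  have inj: "inj_on g (verts X <+> edges X)"
    using assms by (auto simp: symmetry_def Bij_def bij_betw_def)
  fix u w assume "u \<in> verts X" "w \<in> verts X"
  then show "(vact g u = vact g w) = (u = w)"
    using inj_onD[OF inj, of "Inl u" "Inl w"] symmetry_Inl[OF assms] by auto
next
  fix u assume "u \<in> verts X"
  then have "g (Inl u) \<in> Inl ` verts X" using assms by (auto simp: symmetry_def)
  then show "vact g u \<in> verts X" by (auto simp: vact_def)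
next
  fix w assume "w \<in> verts X"
  then have "Inl w \<in> g ` Inl ` verts X" using assms by (simp add: symmetry_def)
  then show "\<exists>u\<in>verts X. w = vact g u" using symmetry_Inl[OF assms] by auto
qed

lemma symmetry_bij_eact:
  assumes "symmetry X g"
  shows "bij_betw (eact g) (edges X) (edges X)"
proof (rule bij_betwI')
  have inj: "inj_on g (verts X <+> edges X)"
    using assms by (auto simp: symmetry_def Bij_def bij_betw_def)
  fix u w assume "u \<in> edges X" "w \<in> edges X"
  then show "(eact g u = eact g w) = (u = w)"
    using inj_onD[OF inj, of "Inr u" "Inr w"] symmetry_Inr[OF assms] by auto
next
  fix u assume "u \<in> edges X"
  then have "g (Inr u) \<in> Inr ` edges X" using assms by (auto simp: symmetry_def)
  then show "eact g u \<in> edges X" by (auto simp: eact_def)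
next
  fix w assume "w \<in> edges X"
  then have "Inr w \<in> g ` Inr ` edges X" using assms by (simp add: symmetry_def)
  then show "\<exists>u\<in>edges X. w = eact g u" using symmetry_Inr[OF assms] by auto
qed

lemma symmetry_ends:
  "symmetry X g \<Longrightarrow> e \<in> edges X \<Longrightarrow> ends X (eact g e) = vact g ` ends X e"
  by (simp add: symmetry_def)

lemma symmetry_vact_in: "symmetry X g \<Longrightarrow> u \<in> verts X \<Longrightarrow> vact g u \<in> verts X"
  using symmetry_bij_vact by (metis bij_betwE)

lemma symmetry_eact_in: "symmetry X g \<Longrightarrow> e \<in> edges X \<Longrightarrow> eact g e \<in> edges X"
  using symmetry_bij_eact by (metis bij_betwE)

lemma vact_restrict: "u \<in> V \<Longrightarrow> vact (restrict (map_sum f h) (V <+> E)) u = f u"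
  by (simp add: vact_def)

lemma eact_restrict: "e \<in> E \<Longrightarrow> eact (restrict (map_sum f h) (V <+> E)) e = h e"
  by (simp add: eact_def)

text \<open>\<open>is_graph X\<close> puts the endvertices of an edge inside \<open>verts X\<close>,
  where the restricted map still acts as \<open>f\<close>. Products, inverses and the induced action
  are all seen to be symmetries in this way.\<close>

lemma symmetryI:
  assumes graph: "is_graph X" and f: "bij_betw f (verts X) (verts X)"
    and h: "bij_betw h (edges X) (edges X)"
    and ends: "\<And>e. e \<in> edges X \<Longrightarrow> ends X (h e) = f ` ends X e"
  shows "symmetry X (restrict (map_sum f h) (verts X <+> edges X))" (is "symmetry X ?g")
proof -
  have V: "?g ` Inl ` verts X = Inl ` verts X"
  proof -
    have "?g ` Inl ` verts X = Inl ` f ` verts X"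
      unfolding image_image by (intro image_cong) auto
    then show ?thesis using f by (simp add: bij_betw_def)
  qed
  have E: "?g ` Inr ` edges X = Inr ` edges X"
  proof -
    have "?g ` Inr ` edges X = Inr ` h ` edges X"
      unfolding image_image by (intro image_cong) auto
    then show ?thesis using h by (simp add: bij_betw_def)
  qed
  have "bij_betw ?g (verts X <+> edges X) (verts X <+> edges X)"
    unfolding bij_betw_def
  proof
    show "inj_on ?g (verts X <+> edges X)"
    proof (rule inj_onI)
      fix x y assume "x \<in> verts X <+> edges X" "y \<in> verts X <+> edges X" "?g x = ?g y"
      then show "x = y"
        using f h by (cases x; cases y) (auto simp: bij_betw_def dest: inj_onD)
    qed
    show "?g ` (verts X <+> edges X) = verts X <+> edges X"
      using arg_cong2[OF V E, of "(\<union>)"] unfolding image_Un[symmetric] Plus_def[symmetric] .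
  qed
  moreover have "ends X (eact ?g e) = vact ?g ` ends X e" if "e \<in> edges X" for e
  proof -
    have "ends X e \<subseteq> verts X" using graph that by (auto simp: is_graph_def)
    then have "vact ?g ` ends X e = f ` ends X e" by (intro image_cong) (auto simp: vact_restrict)
    then show ?thesis using that ends by (simp add: eact_restrict)
  qed
  ultimately show ?thesis using V E by (auto simp: symmetry_def Bij_def)
qed

text \<open>Reduces equations between symmetries, the group axioms among them, to one equation on
  vertices and one on edges.\<close>

lemma symmetry_eqI:
  assumes "symmetry X g" "symmetry X h"
    and "\<And>u. u \<in> verts X \<Longrightarrow> vact g u = vact h u"
    and "\<And>e. e \<in> edges X \<Longrightarrow> eact g e = eact h e"
  shows "g = h"
proof -
  have "restrict (map_sum (vact g) (eact g)) (verts X <+> edges X)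
      = restrict (map_sum (vact h) (eact h)) (verts X <+> edges X)"
    using assms(3,4) by (auto simp: restrict_def fun_eq_iff)
  then show ?thesis using symmetry_eq_map_sum assms(1,2) by metis
qed

section \<open>The group of symmetries\<close>

lemma carrier_aut [simp]: "carrier (aut X) = {g. symmetry X g}"
  by (simp add: aut_def)

lemma mult_aut:
  "symmetry X g \<Longrightarrow> symmetry X h \<Longrightarrow> g \<otimes>\<^bsub>aut X\<^esub> h = compose (verts X <+> edges X) g h"
  by (simp add: aut_def BijGroup_def symmetry_def)

lemma one_aut: "\<one>\<^bsub>aut X\<^esub> = (\<lambda>x \<in> verts X <+> edges X. x)"
  by (simp add: aut_def BijGroup_def)

lemma vact_mult:
  "symmetry X g \<Longrightarrow> symmetry X h \<Longrightarrow> u \<in> verts X \<Longrightarrow> vact (g \<otimes>\<^bsub>aut X\<^esub> h) u = vact g (vact h u)"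
  using symmetry_Inl[of X h u]
  by (simp add: mult_aut compose_def vact_def[of "restrict _ _"] vact_def[of g])

lemma eact_mult:
  "symmetry X g \<Longrightarrow> symmetry X h \<Longrightarrow> e \<in> edges X \<Longrightarrow> eact (g \<otimes>\<^bsub>aut X\<^esub> h) e = eact g (eact h e)"
  using symmetry_Inr[of X h e]
  by (simp add: mult_aut compose_def eact_def[of "restrict _ _"] eact_def[of g])

lemma vact_one: "u \<in> verts X \<Longrightarrow> vact \<one>\<^bsub>aut X\<^esub> u = u"
  by (simp add: one_aut vact_def)

lemma eact_one: "e \<in> edges X \<Longrightarrow> eact \<one>\<^bsub>aut X\<^esub> e = e"
  by (simp add: one_aut eact_def)

text \<open>Puts a product into the shape to which \<open>symmetryI\<close> applies.\<close>

lemma mult_aut_eq_map_sum: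
  assumes "symmetry X g" "symmetry X h"
  shows "g \<otimes>\<^bsub>aut X\<^esub> h =
    restrict (map_sum (vact g \<circ> vact h) (eact g \<circ> eact h)) (verts X <+> edges X)"
proof
  fix x
  show "(g \<otimes>\<^bsub>aut X\<^esub> h) x =
    restrict (map_sum (vact g \<circ> vact h) (eact g \<circ> eact h)) (verts X <+> edges X) x"
    unfolding mult_aut[OF assms]
    using symmetry_Inl[OF assms(1)] symmetry_Inl[OF assms(2)]
      symmetry_Inr[OF assms(1)] symmetry_Inr[OF assms(2)]
      symmetry_vact_in[OF assms(2)] symmetry_eact_in[OF assms(2)]
    by (cases x) (simp_all add: compose_def)
qed

lemma symmetry_mult:
  assumes "is_graph X" "symmetry X g" "symmetry X h"
  shows "symmetry X (g \<otimes>\<^bsub>aut X\<^esub> h)"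
  unfolding mult_aut_eq_map_sum[OF assms(2,3)]
proof (rule symmetryI[OF assms(1)])
  show "bij_betw (vact g \<circ> vact h) (verts X) (verts X)"
    using symmetry_bij_vact assms(2,3) by (blast intro: bij_betw_trans)
  show "bij_betw (eact g \<circ> eact h) (edges X) (edges X)"
    using symmetry_bij_eact assms(2,3) by (blast intro: bij_betw_trans)
qed (use assms in \<open>auto simp: symmetry_ends symmetry_eact_in\<close>)

lemma symmetry_one:
  assumes "is_graph X"
  shows "symmetry X \<one>\<^bsub>aut X\<^esub>"
proof -
  have "\<one>\<^bsub>aut X\<^esub> = restrict (map_sum (\<lambda>u. u) (\<lambda>e. e)) (verts X <+> edges X)"
    by (auto simp: one_aut restrict_def fun_eq_iff)
  then show ?thesis using symmetryI[OF assms, of "\<lambda>u. u" "\<lambda>e. e"] by (simp add: bij_betw_def)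
qed

text \<open>\<open>groupI\<close> asks only for left inverses. The candidate glues the inverses of
  the two actions; it respects endvertices because the equation for \<open>g\<close>, taken at the
  preimage \<open>?k e\<close>, can be cancelled by injectivity of \<open>vact g\<close>.\<close>

lemma symmetry_left_inverse:
  assumes graph: "is_graph X" and g: "symmetry X g"
  shows "\<exists>h. symmetry X h \<and> h \<otimes>\<^bsub>aut X\<^esub> g = \<one>\<^bsub>aut X\<^esub>"
proof -
  let ?f = "inv_into (verts X) (vact g)" and ?k = "inv_into (edges X) (eact g)"
  let ?h = "restrict (map_sum ?f ?k) (verts X <+> edges X)"
  note bv = symmetry_bij_vact[OF g] and be = symmetry_bij_eact[OF g]
  have "ends X (?k e) = ?f ` ends X e" if e: "e \<in> edges X" for e
  proof -
    have k: "?k e \<in> edges X" using be e by (metis bij_betw_def inv_into_into)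
    have "ends X (?k e) \<subseteq> verts X" using graph k by (auto simp: is_graph_def)
    moreover have "ends X e = vact g ` ends X (?k e)"
      using symmetry_ends[OF g k] e be by (simp add: bij_betw_inv_into_right)
    ultimately show ?thesis
      using bv by (simp add: bij_betw_def inv_into_image_cancel)
  qed
  then have h: "symmetry X ?h"
    by (intro symmetryI graph bij_betw_inv_into bv be)
  have "?h \<otimes>\<^bsub>aut X\<^esub> g = \<one>\<^bsub>aut X\<^esub>"
    using bv be by (intro symmetry_eqI[where X = X] symmetry_mult symmetry_one graph h g)
      (auto simp: vact_mult eact_mult h g vact_one eact_one vact_restrict eact_restrict
        symmetry_vact_in symmetry_eact_in bij_betw_inv_into_left)
  then show ?thesis using h by blast
qed

lemma group_aut:
  assumes "is_graph X"
  shows "group (aut X)"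
proof (rule groupI)
  fix x y z assume "x \<in> carrier (aut X)" "y \<in> carrier (aut X)" "z \<in> carrier (aut X)"
  then show "x \<otimes>\<^bsub>aut X\<^esub> y \<otimes>\<^bsub>aut X\<^esub> z = x \<otimes>\<^bsub>aut X\<^esub> (y \<otimes>\<^bsub>aut X\<^esub> z)"
    using assms by (intro symmetry_eqI[where X = X])
      (auto simp: symmetry_mult vact_mult eact_mult symmetry_vact_in symmetry_eact_in)
next
  fix x assume "x \<in> carrier (aut X)"
  then show "\<one>\<^bsub>aut X\<^esub> \<otimes>\<^bsub>aut X\<^esub> x = x"
    using assms by (intro symmetry_eqI[where X = X])
      (auto simp: symmetry_mult symmetry_one vact_mult eact_mult vact_one eact_one
        symmetry_vact_in symmetry_eact_in)
qed (use assms symmetry_left_inverse in \<open>auto simp: symmetry_mult symmetry_one\<close>)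


section \<open>Splits at white vertices\<close>

text \<open>A proper coloring leaves each edge exactly one white endvertex, so the description is
  unique on edges of a 2-colored graph. Together with \<open>black_end\<close> it serves as a pair
  of coordinates on the edges.\<close>

definition white_end :: "('v, 'e) cgraph \<Rightarrow> 'e \<Rightarrow> 'v" where
  "white_end Y e = (THE w. w \<in> ends Y e \<and> col Y w = White)"

definition black_end :: "('v, 'e) cgraph \<Rightarrow> 'e \<Rightarrow> 'v" where
  "black_end Y e = (THE b. b \<in> ends Y e \<and> col Y b = Black)"

locale simple_colored_graph =
  fixes Y :: "('v, 'e) cgraph"
  assumes colored: "is_colored_graph Y" and simple: "simple Y"
begin

lemma graph: "is_graph Y"
  using colored by (simp add: is_colored_graph_def)

lemma ends_subset: "e \<in> edges Y \<Longrightarrow> ends Y e \<subseteq> verts Y"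
  using graph by (simp add: is_graph_def)

lemma ends_ex:
  assumes e: "e \<in> edges Y"
  shows "\<exists>b w. ends Y e = {b, w} \<and> col Y b = Black \<and> col Y w = White"
proof -
  have "card (ends Y e) = 2" using graph e by (simp add: is_graph_def)
  then obtain x y where xy: "ends Y e = {x, y}" "x \<noteq> y" by (meson card_2_iff)
  then have "col Y x \<noteq> col Y y" using colored e by (auto simp: is_colored_graph_def)
  then show ?thesis
    using xy by (cases "col Y x"; cases "col Y y") (auto simp: doubleton_eq_iff)
qed

lemma white_end_eq: "e \<in> edges Y \<Longrightarrow> w \<in> ends Y e \<Longrightarrow> col Y w = White \<Longrightarrow> white_end Y e = w"
  using ends_ex[of e] unfolding white_end_def by (intro the_equality) auto

lemma black_end_eq: "e \<in> edges Y \<Longrightarrow> b \<in> ends Y e \<Longrightarrow> col Y b = Black \<Longrightarrow> black_end Y e = b"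
  using ends_ex[of e] unfolding black_end_def by (intro the_equality) auto

lemma ends_eq: "e \<in> edges Y \<Longrightarrow> ends Y e = {black_end Y e, white_end Y e}"
  using ends_ex[of e] white_end_eq black_end_eq by (metis insertI1 insert_commute)

lemma col_white_end [simp]: "e \<in> edges Y \<Longrightarrow> col Y (white_end Y e) = White"
  using ends_ex[of e] white_end_eq by (metis insertI1 insert_commute)

lemma col_black_end [simp]: "e \<in> edges Y \<Longrightarrow> col Y (black_end Y e) = Black"
  using ends_ex[of e] black_end_eq by (metis insertI1 insert_commute)

lemma white_end_in [simp]: "e \<in> edges Y \<Longrightarrow> white_end Y e \<in> verts Y"
  using ends_subset[of e] ends_eq[of e] by simp

lemma black_end_in [simp]: "e \<in> edges Y \<Longrightarrow> black_end Y e \<in> verts Y"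
  using ends_subset[of e] ends_eq[of e] by simp

text \<open>Simplicity enters here: the two colored endvertices make up the whole set of
  ends.\<close>

lemma edge_eqI:
  "e \<in> edges Y \<Longrightarrow> f \<in> edges Y \<Longrightarrow> white_end Y e = white_end Y f \<Longrightarrow>
    black_end Y e = black_end Y f \<Longrightarrow> e = f"
  using simple by (simp add: simple_def inj_on_def ends_eq)

lemma nbhd_white: "col Y w = White \<Longrightarrow> nbhd Y w = {e \<in> edges Y. white_end Y e = w}"
  unfolding nbhd_def using ends_eq white_end_eq by auto

lemma nbhd_black: "col Y b = Black \<Longrightarrow> nbhd Y b = {e \<in> edges Y. black_end Y e = b}"
  unfolding nbhd_def using ends_eq black_end_eq by auto

lemma
  assumes g: "symmetry Y g" "color_preserving Y g" and e: "e \<in> edges Y"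
  shows white_end_eact: "white_end Y (eact g e) = vact g (white_end Y e)"
    and black_end_eact: "black_end Y (eact g e) = vact g (black_end Y e)"
  using g e ends_eq[OF e] symmetry_ends[OF g(1) e]
  by (auto intro!: white_end_eq black_end_eq simp: symmetry_eact_in color_preserving_def)

end

text \<open>The derived graph and the recovery of \<open>Y\<close> involve no group, so the split is
  arbitrary here. By \<open>no_isolated\<close> every white vertex leaves a trace in the split: some
  part lies at it.\<close>

locale white_split = simple_colored_graph Y for Y :: "('v, 'e) cgraph" +
  fixes S :: "'e set set"
  assumes partition: "partition_on (edges Y) S"
    and card_part: "P \<in> S \<Longrightarrow> card P = 2"
    and common_white: "P \<in> S \<Longrightarrow> e \<in> P \<Longrightarrow> f \<in> P \<Longrightarrow> white_end Y e = white_end Y f"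
    and no_isolated: "w \<in> verts Y \<Longrightarrow> col Y w = White \<Longrightarrow> nbhd Y w \<noteq> {}"
begin

definition part :: "'e \<Rightarrow> 'e set" where
  "part e = (THE P. P \<in> S \<and> e \<in> P)"

text \<open>By \<open>common_white\<close> the choice of the edge in \<open>P\<close> does not
  matter. For white vertices of \<open>Y\<close> these sets turn out to be the classes of
  \<open>Mate Y S\<close>.\<close>

definition white_parts :: "'v \<Rightarrow> 'e set set" where
  "white_parts w = {P \<in> S. \<exists>e \<in> P. white_end Y e = w}"

lemma part_subset: "P \<in> S \<Longrightarrow> P \<subseteq> edges Y"
  using partition by (auto simp: partition_on_def)

lemma part_nonempty: "P \<in> S \<Longrightarrow> \<exists>e. e \<in> P \<and> e \<in> edges Y"
  using part_subset[of P] partition by (cases "P = {}") (auto simp: partition_on_def)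

lemma part_eq: "P \<in> S \<Longrightarrow> e \<in> P \<Longrightarrow> part e = P"
  unfolding part_def using partition
  by (intro the_equality) (auto simp: partition_on_def disjoint_def)

lemma part_in: "e \<in> edges Y \<Longrightarrow> part e \<in> S"
  and in_part: "e \<in> edges Y \<Longrightarrow> e \<in> part e"
  using partition part_eq unfolding partition_on_def by (metis UnionE)+

lemma white_parts_iff: "P \<in> S \<Longrightarrow> e \<in> P \<Longrightarrow> P \<in> white_parts w \<longleftrightarrow> white_end Y e = w"
  unfolding white_parts_def using common_white by blast

lemma arises_from_iff: "P \<in> S \<Longrightarrow> arises_from Y P w \<longleftrightarrow> P \<in> white_parts w"
proof -
  assume P: "P \<in> S"
  then obtain e where e: "e \<in> P" "e \<in> edges Y" using part_nonempty by blast
  have "arises_from Y P w \<longleftrightarrow> white_end Y e = w"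
  proof
    assume "arises_from Y P w"
    then show "white_end Y e = w" using e by (auto simp: arises_from_def intro: white_end_eq)
  next
    assume w: "white_end Y e = w"
    have "w \<in> ends Y f" if "f \<in> P" for f
      using ends_eq[of f] common_white[OF P that e(1)] part_subset[OF P] that w by auto
    then show "arises_from Y P w" using w e by (auto simp: arises_from_def)
  qed
  then show ?thesis using white_parts_iff[OF P e(1)] by simp
qed

lemma Mate_iff: "(P, Q) \<in> Mate Y S \<longleftrightarrow> (\<exists>w. P \<in> white_parts w \<and> Q \<in> white_parts w)"
  unfolding Mate_def using arises_from_iff by (auto simp: white_parts_def)

lemma white_parts_disjoint: "P \<in> white_parts w \<Longrightarrow> P \<in> white_parts w' \<Longrightarrow> w = w'"
  unfolding white_parts_def using common_white by blast

lemma Mate_image: "P \<in> white_parts w \<Longrightarrow> Mate Y S `` {P} = white_parts w"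
  using Mate_iff white_parts_disjoint by blast

section \<open>The derived graph and its mate relation\<close>

lemma Dis_simps [simp]:
  "verts (Dis Y S) = {b \<in> verts Y. col Y b = Black}" "edges (Dis Y S) = S"
  by (simp_all add: Dis_def)

lemma ends_Dis: "P \<in> S \<Longrightarrow> ends (Dis Y S) P = black_end Y ` P"
  unfolding Dis_def using part_subset[of P] ends_eq black_end_eq by (auto 4 4)

text \<open>Two edges of a part already share their white end, so a common black end would make them
  parallel. Hence an edge of the derived graph has two distinct endvertices.\<close>

lemma inj_on_black_end: "P \<in> S \<Longrightarrow> inj_on (black_end Y) P"
  using common_white edge_eqI part_subset by (meson inj_onI subsetD)

lemma finite_S: "finite S"
  using graph partition by (auto simp: is_graph_def intro: finite_elements)

lemma is_graph_Dis: "is_graph (Dis Y S)"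
  unfolding is_graph_def
proof (intro conjI ballI)
  show "finite (verts (Dis Y S))" using graph by (simp add: is_graph_def)
  show "finite (edges (Dis Y S))" by (simp add: finite_S)
  fix P assume "P \<in> edges (Dis Y S)"
  then have P: "P \<in> S" by simp
  show "ends (Dis Y S) P \<subseteq> verts (Dis Y S)" using ends_Dis[OF P] part_subset[OF P] by auto
  show "card (ends (Dis Y S) P) = 2"
    using P by (simp add: ends_Dis card_image inj_on_black_end card_part)
qed

lemma nbhd_Dis:
  assumes "col Y b = Black"
  shows "nbhd (Dis Y S) b = part ` nbhd Y b"
proof
  show "nbhd (Dis Y S) b \<subseteq> part ` nbhd Y b"
    using part_subset part_eq by (fastforce simp: nbhd_def[of "Dis Y S"] ends_Dis nbhd_black assms)
  show "part ` nbhd Y b \<subseteq> nbhd (Dis Y S) b"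
    using part_in in_part by (fastforce simp: nbhd_def[of "Dis Y S"] ends_Dis nbhd_black assms)
qed

lemma valent_Dis:
  assumes "\<forall>b \<in> verts Y. col Y b = Black \<longrightarrow> valency Y b = k"
  shows "valent k (Dis Y S)"
  unfolding valent_def
proof
  fix b assume b: "b \<in> verts (Dis Y S)"
  \<comment> \<open>No two edges at \<open>b\<close> are merged: in one part they would share the
    white end as well as \<open>b\<close>.\<close>
  have "inj_on part (nbhd Y b)"
  proof (rule inj_onI)
    fix e f assume ef: "e \<in> nbhd Y b" "f \<in> nbhd Y b" "part e = part f"
    then have ed: "e \<in> edges Y" "f \<in> edges Y" by (auto simp: nbhd_def)
    then have "white_end Y e = white_end Y f" using common_white part_in in_part ef(3) by metis
    then show "e = f" using edge_eqI[OF ed] ef b nbhd_black by auto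
  qed
  then show "valency (Dis Y S) b = k"
    using b assms by (simp add: valency_def nbhd_Dis card_image)
qed

lemma separating_Mate: "separating_relation (Dis Y S) (Mate Y S)"
proof -
  have "equiv S (Mate Y S)"
  proof (rule equivI)
    show "Mate Y S \<subseteq> S \<times> S" by (auto simp: Mate_def)
    show "refl_on S (Mate Y S)"
      using Mate_iff part_nonempty white_parts_iff by (fastforce simp: refl_on_def)
    show "sym (Mate Y S)" by (auto simp: sym_def Mate_iff)
    show "trans (Mate Y S)" unfolding trans_def Mate_iff using white_parts_disjoint by blast
  qed
  moreover have "P = Q" if PQ: "(P, Q) \<in> Mate Y S" and adj: "adjacent (Dis Y S) P Q" for P Q
  proof -
    have S: "P \<in> S" "Q \<in> S" using PQ by (auto simp: Mate_def)
    obtain e f where ef: "e \<in> P" "f \<in> Q" "black_end Y e = black_end Y f"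
      using adj S by (auto simp: adjacent_def ends_Dis)
    \<comment> \<open>Mates arise from one white vertex, so \<open>e\<close> and \<open>f\<close>
      agree in both ends. Simplicity forces \<open>e = f\<close>, and two parts that meet are
      equal.\<close>
    have "white_end Y e = white_end Y f" using PQ Mate_iff white_parts_iff S ef by metis
    then have "e = f" using edge_eqI ef part_subset S by blast
    then show ?thesis using part_eq S ef by metis
  qed
  ultimately show ?thesis unfolding separating_relation_def by auto
qed

text \<open>A class is \<open>white_parts\<close> of some white vertex, and its members cut the four
  edges there into pairs.\<close>

lemma card_Mate_class:
  assumes 4: "\<forall>w \<in> verts Y. col Y w = White \<longrightarrow> valency Y w = 4" and C: "C \<in> S // Mate Y S"
  shows "card C = 2"
proof -
  obtain P where P: "P \<in> S" "C = Mate Y S `` {P}" using C by (auto elim: quotientE)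
  obtain e where e: "e \<in> P" "e \<in> edges Y" using part_nonempty P by blast
  let ?w = "white_end Y e"
  have "P \<in> white_parts ?w" using white_parts_iff P e by simp
  then have C: "C = white_parts ?w" using Mate_image P by simp
  have un: "\<Union> C = nbhd Y ?w"
  proof (intro equalityI subsetI)
    fix f assume "f \<in> \<Union> C"
    then obtain Q where Q: "Q \<in> S" "Q \<in> white_parts ?w" "f \<in> Q"
      unfolding C white_parts_def by blast
    then have "white_end Y f = ?w" "f \<in> edges Y" using white_parts_iff part_subset[OF Q(1)] by auto
    then show "f \<in> nbhd Y ?w" using nbhd_white e by simp
  next
    fix f assume "f \<in> nbhd Y ?w"
    then have f: "f \<in> edges Y" "white_end Y f = ?w" using nbhd_white e by auto
    then have "part f \<in> white_parts ?w" using white_parts_iff part_in in_part by metis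
    then show "f \<in> \<Union> C" using in_part f C by blast
  qed
  have CS: "C \<subseteq> S" by (auto simp: C white_parts_def)
  have "card (\<Union> C) = sum card C"
  proof (rule card_Union_disjoint)
    show "pairwise disjnt C"
      using partition_onD2[OF partition] CS by (rule pairwise_subset)
    show "\<And>A. A \<in> C \<Longrightarrow> finite A" using CS card_part by (metis card.infinite subsetD zero_neq_numeral)
  qed
  also have "\<dots> = 2 * card C" using CS card_part by (simp add: subset_iff)
  finally show ?thesis using un 4 e by (simp add: valency_def)
qed

section \<open>Recovery of the graph from the subdivision of the derived graph\<close>

definition quotient_vertex :: "'v \<Rightarrow> ('v + 'e set) set" where
  "quotient_vertex u = (if col Y u = Black then {Inl u} else Inr ` white_parts u)"

text \<open>The darts of the derived graph are the edges of its subdivision, so this is the edge map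
  of the isomorphism before passing to the quotient.\<close>

definition split_dart :: "'e \<Rightarrow> 'e set \<times> 'v" where
  "split_dart e = (part e, black_end Y e)"

lemma white_parts_nonempty:
  assumes "w \<in> verts Y" "col Y w = White"
  shows "\<exists>P. P \<in> white_parts w"
proof -
  obtain e where "e \<in> edges Y" "white_end Y e = w"
    using no_isolated[OF assms] nbhd_white assms by auto
  then show ?thesis using white_parts_iff part_in in_part by metis
qed

lemma extend_relation_black:
  assumes "b \<in> verts Y" "col Y b = Black"
  shows "extend_relation (Dis Y S) (Mate Y S) `` {Inl b} = quotient_vertex b"
  using assms by (auto simp: extend_relation_def quotient_vertex_def)

lemma extend_relation_white:
  assumes "P \<in> white_parts w" "col Y w = White"
  shows "extend_relation (Dis Y S) (Mate Y S) `` {Inr P} = quotient_vertex w"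
proof -
  have "extend_relation (Dis Y S) (Mate Y S) `` {Inr P} = Inr ` (Mate Y S `` {P})"
    by (auto simp: extend_relation_def)
  then show ?thesis using assms by (simp add: Mate_image quotient_vertex_def)
qed

text \<open>A black vertex is read off from \<open>Inl\<close>. A white vertex is determined by any
  part in its set, and that set is nonempty because the vertex is not isolated.\<close>

lemma inj_on_quotient_vertex: "inj_on quotient_vertex (verts Y)"
proof (rule inj_onI)
  fix u w assume uw: "u \<in> verts Y" "w \<in> verts Y" "quotient_vertex u = quotient_vertex w"
  show "u = w"
  proof (cases "col Y u = Black \<or> col Y w = Black")
    case True
    then show ?thesis using uw(3) by (auto simp: quotient_vertex_def split: if_splits)
  next
    case False
    then have col: "col Y u = White" "col Y w = White" by (metis colour.exhaust)+
    then have "white_parts u = white_parts w"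
      using uw(3) by (simp add: quotient_vertex_def inj_image_eq_iff)
    then show ?thesis using white_parts_nonempty[OF uw(1) col(1)] white_parts_disjoint by metis
  qed
qed

text \<open>A dart \<open>(P, b)\<close> points to the black end of some edge in \<open>P\<close>,
  and \<open>P\<close> is the part of that edge.\<close>

lemma darts_Dis: "darts (Dis Y S) = split_dart ` edges Y"
proof (intro equalityI subsetI)
  fix d assume "d \<in> darts (Dis Y S)"
  then obtain P e where P: "P \<in> S" "e \<in> P" "d = (P, black_end Y e)"
    by (auto simp: darts_def ends_Dis)
  then have "d = split_dart e" "e \<in> edges Y"
    using part_eq part_subset[OF P(1)] by (auto simp: split_dart_def)
  then show "d \<in> split_dart ` edges Y" by blast
next
  fix d assume "d \<in> split_dart ` edges Y"
  then show "d \<in> darts (Dis Y S)"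
    using part_in in_part by (auto simp: darts_def ends_Dis split_dart_def)
qed

lemma quotient_ends_split_dart:
  assumes e: "e \<in> edges Y"
  shows "quotient_ends (subdivision (Dis Y S)) (extend_relation (Dis Y S) (Mate Y S)) (split_dart e)
    = quotient_vertex ` ends Y e"
proof -
  have "part e \<in> white_parts (white_end Y e)" using white_parts_iff part_in in_part e by metis
  then show ?thesis
    using e by (simp add: quotient_ends_def subdivision_def split_dart_def ends_eq
        extend_relation_white extend_relation_black insert_commute)
qed

text \<open>Equal quotient ends come from edges of \<open>Y\<close> with equal ends, since
  \<open>quotient_vertex\<close> is injective, and simplicity then leaves one edge. So the quotient
  identifies white vertices without merging edges.\<close>

lemma quotient_edge_split_dart:
  assumes e: "e \<in> edges Y"
  shows "quotient_edge (subdivision (Dis Y S)) (extend_relation (Dis Y S) (Mate Y S)) (split_dart e)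
    = {split_dart e}"
proof -
  have "f = e" if f: "f \<in> edges Y" "quotient_vertex ` ends Y f = quotient_vertex ` ends Y e" for f
  proof -
    have "ends Y f = ends Y e"
      using inj_on_image_eq_iff[OF inj_on_quotient_vertex] ends_subset e f by metis
    then show ?thesis using simple e f(1) by (simp add: simple_def inj_on_def)
  qed
  moreover have "edges (subdivision (Dis Y S)) = split_dart ` edges Y"
    by (simp add: subdivision_def darts_Dis)
  ultimately show ?thesis
    using e unfolding quotient_edge_def
    by (auto simp: quotient_ends_split_dart) metis+
qed

lemma quotient_vertex_image:
  "quotient_vertex ` verts Y
    = (verts (Dis Y S) <+> S) // extend_relation (Dis Y S) (Mate Y S)" (is "_ = _ // ?R")
proof (intro equalityI subsetI)
  fix U assume "U \<in> quotient_vertex ` verts Y"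
  then obtain u where u: "u \<in> verts Y" "U = quotient_vertex u" by blast
  show "U \<in> (verts (Dis Y S) <+> S) // ?R"
  proof (cases "col Y u")
    case Black
    then have "U = ?R `` {Inl u}" using u extend_relation_black by simp
    then show ?thesis using u Black by (auto intro: quotientI)
  next
    case White
    then obtain P where P: "P \<in> white_parts u" using white_parts_nonempty u by blast
    then have "U = ?R `` {Inr P}" using u White extend_relation_white by simp
    moreover have "P \<in> S" using P by (simp add: white_parts_def)
    ultimately show ?thesis by (auto intro: quotientI)
  qed
next
  fix U assume "U \<in> (verts (Dis Y S) <+> S) // ?R"
  then obtain x where x: "x \<in> verts (Dis Y S) <+> S" "U = ?R `` {x}" by (rule quotientE)
  from x(1) show "U \<in> quotient_vertex ` verts Y"
  proof
    fix b assume "b \<in> verts (Dis Y S)" "x = Inl b"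
    then show ?thesis using x(2) extend_relation_black by auto
  next
    fix P assume P: "P \<in> S" "x = Inr P"
    then obtain e where e: "e \<in> P" "e \<in> edges Y" using part_nonempty by blast
    then have "P \<in> white_parts (white_end Y e)" using white_parts_iff P by simp
    then show ?thesis using x(2) P e extend_relation_white by simp
  qed
qed

lemma colored_isomorphic_BGCG: "colored_isomorphic Y (BGCG (Dis Y S) (Mate Y S))"
proof -
  let ?R = "extend_relation (Dis Y S) (Mate Y S)" and ?Z = "BGCG (Dis Y S) (Mate Y S)"
  let ?h = "\<lambda>e. {split_dart e}"
  have verts: "verts ?Z = quotient_vertex ` verts Y"
    unfolding quotient_vertex_image by (simp add: BGCG_def quotient_graph_def subdivision_def)
  have "edges ?Z = quotient_edge (subdivision (Dis Y S)) ?R ` split_dart ` edges Y"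
    by (simp add: BGCG_def quotient_graph_def subdivision_def darts_Dis)
  then have edges: "edges ?Z = ?h ` edges Y"
    by (simp add: image_image quotient_edge_split_dart)
  have ends: "ends ?Z (?h e) = quotient_vertex ` ends Y e" if "e \<in> edges Y" for e
    using that by (simp add: BGCG_def quotient_graph_def quotient_ends_split_dart)
  have col: "col ?Z (quotient_vertex u) = col Y u" if u: "u \<in> verts Y" for u
  proof (cases "col Y u")
    case Black
    then show ?thesis
      by (simp add: BGCG_def quotient_graph_def subdivision_def quotient_vertex_def)
  next
    case White
    \<comment> \<open>\<open>the_elem\<close> in \<open>quotient_graph\<close> needs the colors of a
      class to form a singleton, so the class must be nonempty.\<close>
    then have "white_parts u \<noteq> {}" using white_parts_nonempty u by blast
    then have "case_sum (\<lambda>_. Black) (\<lambda>_. White) ` quotient_vertex u = {White}"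
      using White by (auto simp: quotient_vertex_def image_image)
    then show ?thesis
      using White by (simp add: BGCG_def quotient_graph_def subdivision_def)
  qed
  have "inj_on ?h (edges Y)"
  proof (rule inj_onI)
    fix e f assume ef: "e \<in> edges Y" "f \<in> edges Y" "?h e = ?h f"
    then have "part e = part f" "black_end Y e = black_end Y f" by (auto simp: split_dart_def)
    then show "e = f"
      using ef(1,2) edge_eqI inj_on_black_end part_in in_part by (metis inj_onD)
  qed
  then have "bij_betw ?h (edges Y) (edges ?Z)" using edges by (simp add: bij_betw_def)
  moreover have "bij_betw quotient_vertex (verts Y) (verts ?Z)"
    using verts inj_on_quotient_vertex by (simp add: bij_betw_def)
  ultimately show ?thesis using ends col unfolding colored_isomorphic_def by blast
qed

end


section \<open>The induced action on the derived graph\<close>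

locale bi_transitive_graph = simple_colored_graph Y for Y :: "('v, 'e) cgraph" +
  fixes G :: "('v + 'e \<Rightarrow> 'v + 'e) set"
  assumes bi_transitive: "bi_transitive G Y"
begin

lemma subgroup_G: "subgroup G (aut Y)"
  using bi_transitive by (simp add: bi_transitive_def)

lemma symmetry_G: "g \<in> G \<Longrightarrow> symmetry Y g"
  using subgroup.subset[OF subgroup_G] by auto

lemma color_preserving_G: "g \<in> G \<Longrightarrow> color_preserving Y g"
  using bi_transitive by (simp add: bi_transitive_def)

lemma edge_transitive: "e \<in> edges Y \<Longrightarrow> f \<in> edges Y \<Longrightarrow> \<exists>g \<in> G. eact g e = f"
  using bi_transitive by (simp add: bi_transitive_def)

lemma mult_G: "g \<in> G \<Longrightarrow> h \<in> G \<Longrightarrow> g \<otimes>\<^bsub>aut Y\<^esub> h \<in> G"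
  using subgroup.m_closed[OF subgroup_G] .

lemma inv_G: "g \<in> G \<Longrightarrow> inv\<^bsub>aut Y\<^esub> g \<in> G"
  using subgroup.m_inv_closed[OF subgroup_G] .

lemma vact_in: "g \<in> G \<Longrightarrow> u \<in> verts Y \<Longrightarrow> vact g u \<in> verts Y"
  by (rule symmetry_vact_in[OF symmetry_G])

lemma eact_in: "g \<in> G \<Longrightarrow> e \<in> edges Y \<Longrightarrow> eact g e \<in> edges Y"
  by (rule symmetry_eact_in[OF symmetry_G])

lemma col_vact: "g \<in> G \<Longrightarrow> u \<in> verts Y \<Longrightarrow> col Y (vact g u) = col Y u"
  using color_preserving_G by (simp add: color_preserving_def)

lemma vact_mult_G: "g \<in> G \<Longrightarrow> h \<in> G \<Longrightarrow> u \<in> verts Y \<Longrightarrow>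
    vact (g \<otimes>\<^bsub>aut Y\<^esub> h) u = vact g (vact h u)"
  by (simp add: vact_mult symmetry_G)

lemma eact_mult_G: "g \<in> G \<Longrightarrow> h \<in> G \<Longrightarrow> e \<in> edges Y \<Longrightarrow>
    eact (g \<otimes>\<^bsub>aut Y\<^esub> h) e = eact g (eact h e)"
  by (simp add: eact_mult symmetry_G)

lemma
  assumes g: "g \<in> G"
  shows vact_inv_cancel: "u \<in> verts Y \<Longrightarrow> vact (inv\<^bsub>aut Y\<^esub> g) (vact g u) = u"
    and eact_inv_cancel: "e \<in> edges Y \<Longrightarrow> eact g (eact (inv\<^bsub>aut Y\<^esub> g) e) = e"
proof -
  have "inv\<^bsub>aut Y\<^esub> g \<otimes>\<^bsub>aut Y\<^esub> g = \<one>\<^bsub>aut Y\<^esub>" "g \<otimes>\<^bsub>aut Y\<^esub> inv\<^bsub>aut Y\<^esub> g = \<one>\<^bsub>aut Y\<^esub>"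
    using group.l_inv[OF group_aut[OF graph]] group.r_inv[OF group_aut[OF graph]] symmetry_G[OF g]
    by auto
  then show "u \<in> verts Y \<Longrightarrow> vact (inv\<^bsub>aut Y\<^esub> g) (vact g u) = u"
    "e \<in> edges Y \<Longrightarrow> eact g (eact (inv\<^bsub>aut Y\<^esub> g) e) = e"
    using vact_mult_G[OF inv_G[OF g] g] eact_mult_G[OF g inv_G[OF g]] vact_one eact_one
    by metis+
qed

lemma white_end_eact_G: "g \<in> G \<Longrightarrow> e \<in> edges Y \<Longrightarrow> white_end Y (eact g e) = vact g (white_end Y e)"
  by (rule white_end_eact[OF symmetry_G color_preserving_G])

lemma black_end_eact_G: "g \<in> G \<Longrightarrow> e \<in> edges Y \<Longrightarrow> black_end Y (eact g e) = vact g (black_end Y e)"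
  by (rule black_end_eact[OF symmetry_G color_preserving_G])

lemma inj_on_eact: "g \<in> G \<Longrightarrow> inj_on (eact g) (edges Y)"
  by (rule bij_betw_imp_inj_on[OF symmetry_bij_eact[OF symmetry_G]])

lemma inj_on_vact: "g \<in> G \<Longrightarrow> inj_on (vact g) (verts Y)"
  by (rule bij_betw_imp_inj_on[OF symmetry_bij_vact[OF symmetry_G]])

end

locale invariant_split = white_split Y S + bi_transitive_graph Y G
  for Y :: "('v, 'e) cgraph" and S G +
  assumes invariant: "g \<in> G \<Longrightarrow> P \<in> S \<Longrightarrow> eact g ` P \<in> S"
begin

lemma vact_Dis_action: "b \<in> verts Y \<Longrightarrow> col Y b = Black \<Longrightarrow> vact (Dis_action Y S g) b = vact g b"
  unfolding Dis_action_def by (subst vact_restrict) auto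

lemma eact_Dis_action: "P \<in> S \<Longrightarrow> eact (Dis_action Y S g) P = eact g ` P"
  unfolding Dis_action_def by (subst eact_restrict) auto

lemma ends_image:
  assumes "g \<in> G" "P \<in> S"
  shows "black_end Y ` eact g ` P = vact g ` black_end Y ` P"
  unfolding image_image using assms(1) part_subset[OF assms(2)]
  by (intro image_cong) (auto simp: black_end_eact_G)

lemma symmetry_Dis_action:
  assumes g: "g \<in> G"
  shows "symmetry (Dis Y S) (Dis_action Y S g)"
  unfolding Dis_action_def
proof (rule symmetryI[OF is_graph_Dis])
  let ?B = "verts (Dis Y S)"
  have "inj_on (vact g) ?B" using inj_on_vact[OF g] by (rule inj_on_subset) auto
  moreover have "vact g ` ?B \<subseteq> ?B" using vact_in g col_vact by auto
  moreover have "finite ?B" using is_graph_Dis by (simp add: is_graph_def)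
  \<comment> \<open>An injective self-map of a finite set is onto; the parts are treated in the same
    way below.\<close>
  ultimately show "bij_betw (vact g) ?B ?B" unfolding bij_betw_def by (simp only: endo_inj_surj)
  have "inj_on ((`) (eact g)) S"
    using inj_on_image_eq_iff[OF inj_on_eact[OF g]] part_subset by (auto intro!: inj_onI)
  moreover have "(`) (eact g) ` S \<subseteq> S" using invariant g by auto
  ultimately show "bij_betw ((`) (eact g)) (edges (Dis Y S)) (edges (Dis Y S))"
    unfolding bij_betw_def by (simp add: endo_inj_surj finite_S)
  fix P assume "P \<in> edges (Dis Y S)"
  then show "ends (Dis Y S) (eact g ` P) = vact g ` ends (Dis Y S) P"
    using g by (simp add: ends_Dis invariant ends_image)
qed

lemma Dis_action_hom:
  assumes g: "g \<in> G" and h: "h \<in> G"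
  shows "Dis_action Y S (g \<otimes>\<^bsub>aut Y\<^esub> h) = Dis_action Y S g \<otimes>\<^bsub>aut (Dis Y S)\<^esub> Dis_action Y S h"
proof (rule symmetry_eqI)
  show "symmetry (Dis Y S) (Dis_action Y S (g \<otimes>\<^bsub>aut Y\<^esub> h))"
    by (rule symmetry_Dis_action[OF mult_G[OF g h]])
  show "symmetry (Dis Y S) (Dis_action Y S g \<otimes>\<^bsub>aut (Dis Y S)\<^esub> Dis_action Y S h)"
    by (rule symmetry_mult[OF is_graph_Dis symmetry_Dis_action[OF g] symmetry_Dis_action[OF h]])
next
  fix u assume u: "u \<in> verts (Dis Y S)"
  then show "vact (Dis_action Y S (g \<otimes>\<^bsub>aut Y\<^esub> h)) u
      = vact (Dis_action Y S g \<otimes>\<^bsub>aut (Dis Y S)\<^esub> Dis_action Y S h) u"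
    unfolding vact_mult[OF symmetry_Dis_action[OF g] symmetry_Dis_action[OF h] u]
    using g h by (simp add: vact_Dis_action vact_mult_G vact_in col_vact)
next
  fix P assume P: "P \<in> edges (Dis Y S)"
  then have "eact (g \<otimes>\<^bsub>aut Y\<^esub> h) ` P = eact g ` eact h ` P"
    unfolding image_image using part_subset g h
    by (intro image_cong) (auto simp: eact_mult_G subset_iff)
  then show "eact (Dis_action Y S (g \<otimes>\<^bsub>aut Y\<^esub> h)) P
      = eact (Dis_action Y S g \<otimes>\<^bsub>aut (Dis Y S)\<^esub> Dis_action Y S h) P"
    unfolding eact_mult[OF symmetry_Dis_action[OF g] symmetry_Dis_action[OF h] P]
    using g h P by (simp add: eact_Dis_action invariant)
qed

lemma inj_on_Dis_action: "inj_on (Dis_action Y S) G"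
proof (rule inj_onI)
  fix g h assume g: "g \<in> G" and h: "h \<in> G" and eq: "Dis_action Y S g = Dis_action Y S h"
  have black: "vact g b = vact h b" if "b \<in> verts Y" "col Y b = Black" for b
    using vact_Dis_action[OF that] eq by metis
  have white_end: "white_end Y (eact g e) = white_end Y (eact h e)" if e: "e \<in> edges Y" for e
  proof -
    have "eact g ` part e = eact h ` part e" using eact_Dis_action[OF part_in[OF e]] eq by metis
    \<comment> \<open>Equal actions on parts put both images of \<open>e\<close> into one part,
      whose edges have a common white end.\<close>
    then have "eact h e \<in> eact g ` part e" "eact g e \<in> eact g ` part e" using in_part[OF e] by auto
    then show ?thesis using common_white invariant[OF g part_in[OF e]] by blast
  qed
  have edge: "eact g e = eact h e" if e: "e \<in> edges Y" for e
    using e g h by (intro edge_eqI) (simp_all add: eact_in white_end black_end_eact_G black)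
  have vert: "vact g u = vact h u" if u: "u \<in> verts Y" for u
  proof (cases "col Y u")
    case White
    \<comment> \<open>A white vertex is not a vertex of the derived graph. It is reached through an
      edge at it, whose images under \<open>g\<close> and \<open>h\<close> have the same white
      end.\<close>
    then obtain e where "e \<in> edges Y" "white_end Y e = u"
      using no_isolated[OF u] nbhd_white by auto
    then show ?thesis using white_end white_end_eact_G g h by metis
  qed (use black u in simp)
  show "g = h" using symmetry_eqI[OF symmetry_G[OF g] symmetry_G[OF h]] vert edge by blast
qed

lemma acts_Dis: "acts_as_symmetries Y G (Dis_action Y S) (Dis Y S)"
  unfolding acts_as_symmetries_def hom_def
  using symmetry_Dis_action Dis_action_hom inj_on_Dis_action by auto

text \<open>Darts correspond to edges of \<open>Y\<close> through \<open>split_dart\<close>, and the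
  correspondence respects the two actions, so edge-transitivity becomes dart-transitivity.\<close>

lemma dart_transitive_Dis: "dart_transitive (Dis_action Y S ` G) (Dis Y S)"
proof -
  have "group_hom ((aut Y)\<lparr>carrier := G\<rparr>) (aut (Dis Y S)) (Dis_action Y S)"
    using acts_Dis subgroup.subgroup_is_group[OF subgroup_G group_aut[OF graph]]
      group_aut[OF is_graph_Dis]
    by (simp add: group_hom_def group_hom_axioms_def acts_as_symmetries_def)
  then have "subgroup (Dis_action Y S ` G) (aut (Dis Y S))"
    using group_hom.img_is_subgroup by fastforce
  moreover have "\<exists>k \<in> Dis_action Y S ` G. eact k P = Q \<and> vact k b = c"
    if d: "(P, b) \<in> darts (Dis Y S)" "(Q, c) \<in> darts (Dis Y S)" for P b Q c
  proof -
    obtain e f where ef: "e \<in> edges Y" "f \<in> edges Y"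
      and Pb: "P = part e" "b = black_end Y e" and Qc: "Q = part f" "c = black_end Y f"
      using d by (auto simp: darts_Dis split_dart_def)
    obtain g where g: "g \<in> G" "eact g e = f" using edge_transitive ef by blast
    have "f \<in> eact g ` P" using g(2) Pb in_part ef by blast
    then have "Q = eact g ` P" using part_eq invariant part_in g ef Pb Qc by metis
    moreover have "c = vact g b" using black_end_eact_G g ef Pb Qc by metis
    ultimately show ?thesis
      using g(1) ef Pb part_in eact_Dis_action vact_Dis_action by (auto intro!: bexI[of _ g])
  qed
  ultimately show ?thesis unfolding dart_transitive_def by blast
qed

text \<open>An element \<open>g\<close> carries parts at \<open>w\<close> to parts at
  \<open>vact g w\<close>, so parts arising from one white vertex stay together.\<close>

lemma invariant_Mate: "invariant_relation (Dis_action Y S ` G) (Mate Y S)"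
proof -
  have "(eact (Dis_action Y S g) P, eact (Dis_action Y S g) Q) \<in> Mate Y S"
    if g: "g \<in> G" and PQ: "(P, Q) \<in> Mate Y S" for g P Q
  proof -
    obtain w where w: "P \<in> white_parts w" "Q \<in> white_parts w" using PQ Mate_iff by blast
    have "eact (Dis_action Y S g) R \<in> white_parts (vact g w)" if R: "R \<in> white_parts w" for R
    proof -
      obtain e where e: "R \<in> S" "e \<in> R" "white_end Y e = w" using R by (auto simp: white_parts_def)
      then have "white_end Y (eact g e) = vact g w" using white_end_eact_G[OF g] part_subset by blast
      then show ?thesis using white_parts_iff[of "eact g ` R" "eact g e"] invariant[OF g] e
        by (simp add: eact_Dis_action)
    qed
    then show ?thesis using w Mate_iff by blast
  qed
  then show ?thesis unfolding invariant_relation_def by blast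
qed

lemma BGCG_representation_Dis:
  assumes "\<forall>b \<in> verts Y. col Y b = Black \<longrightarrow> valency Y b = k"
    and "\<forall>w \<in> verts Y. col Y w = White \<longrightarrow> valency Y w = 4"
  shows "BGCG_representation Y G k (Dis Y S) (Mate Y S) (Dis_action Y S)"
  unfolding BGCG_representation_def
  using is_graph_Dis valent_Dis acts_Dis dart_transitive_Dis separating_Mate invariant_Mate
    card_Mate_class colored_isomorphic_BGCG assms by simp

end


section \<open>The split given by an imprimitivity system\<close>

locale white_block_system = bi_transitive_graph Y G for Y :: "('v, 'e) cgraph" and G +
  fixes v :: 'v and D :: "'e set set"
  assumes v: "v \<in> verts Y" "col Y v = White"
    and valency_white: "w \<in> verts Y \<Longrightarrow> col Y w = White \<Longrightarrow> valency Y w = 4"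
    and system: "imprimitivity_system (local_group Y G v) (nbhd Y v) D"
begin

lemma card_nbhd: "w \<in> verts Y \<Longrightarrow> col Y w = White \<Longrightarrow> card (nbhd Y w) = 4"
  using valency_white by (simp add: valency_def)

lemma white_no_isolated: "w \<in> verts Y \<Longrightarrow> col Y w = White \<Longrightarrow> nbhd Y w \<noteq> {}"
  using card_nbhd by fastforce

lemma partition_D: "partition_on (nbhd Y v) D"
  using system by (simp add: imprimitivity_system_def)

lemma block_subset: "B \<in> D \<Longrightarrow> B \<subseteq> {e \<in> edges Y. white_end Y e = v}"
  using partition_onD1[OF partition_D] v nbhd_white by auto

lemma eact_block:
  assumes g: "g \<in> G" "vact g v = v" and B: "B \<in> D"
  shows "eact g ` B \<in> D"
proof -
  have "restrict (eact g) (nbhd Y v) \<in> local_group Y G v"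
    using g by (auto simp: local_group_def vertex_stabilizer_def)
  then have "restrict (eact g) (nbhd Y v) ` B \<in> D"
    using system B unfolding imprimitivity_system_def by blast
  \<comment> \<open>The local group consists of restricted maps; on a block, which lies in
    \<open>nbhd Y v\<close>, restriction changes nothing.\<close>
  moreover have "restrict (eact g) (nbhd Y v) ` B = eact g ` B"
    using partition_onD1[OF partition_D] B by (intro image_cong) auto
  ultimately show ?thesis by simp
qed

text \<open>An element taking an edge at \<open>v\<close> to an edge at \<open>v\<close> fixes
  \<open>v\<close>, because colors are preserved. So edge-transitivity makes the stabilizer of
  \<open>v\<close> transitive on the blocks: two blocks that share \<open>f\<close>
  coincide.\<close>

lemma card_block_eq:
  assumes B: "B \<in> D" and C: "C \<in> D"
  shows "card B = card C"
proof -
  have "B \<noteq> {}" "C \<noteq> {}" using partition_onD3[OF partition_D] B C by auto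
  then obtain e f where ef: "e \<in> B" "f \<in> C" by blast
  then have ends: "e \<in> edges Y" "f \<in> edges Y" "white_end Y e = v" "white_end Y f = v"
    using block_subset B C by auto
  obtain g where g: "g \<in> G" "eact g e = f" using edge_transitive ends by blast
  then have "vact g v = v" using white_end_eact_G ends by metis
  then have "eact g ` B \<in> D" using eact_block g B by blast
  moreover have "f \<in> eact g ` B" using ef g by blast
  ultimately have "eact g ` B = C"
    using partition_onD2[OF partition_D] C ef by (auto dest: disjointD)
  moreover have "inj_on (eact g) B"
    using inj_on_eact[OF g(1)] block_subset[OF B] by (auto intro: inj_on_subset)
  ultimately show ?thesis by (metis card_image)
qed

lemma card_block:
  assumes B: "B \<in> D"
  shows "card B = 2"
proof -
  have fin: "finite (nbhd Y v)" using card_nbhd[OF v] by (metis card.infinite zero_neq_numeral)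
  have sub: "C \<subseteq> nbhd Y v" if "C \<in> D" for C
    using partition_onD1[OF partition_D] that by blast
  have "card (\<Union> D) = sum card D"
  proof (rule card_Union_disjoint)
    show "disjoint D" by (rule partition_onD2[OF partition_D])
    show "\<And>C. C \<in> D \<Longrightarrow> finite C" using sub fin by (auto intro: finite_subset)
  qed
  also have "\<dots> = (\<Sum>C\<in>D. card B)" by (intro sum.cong card_block_eq[OF _ B] refl)
  also have "\<dots> = card D * card B" by simp
  finally have 4: "card D * card B = 4"
    using card_nbhd[OF v] partition_onD1[OF partition_D] by simp
  then have "card B dvd 4" by (metis dvd_triv_right)
  \<comment> \<open>Blocks of equal size partition four edges, so that size divides 4. Sizes 1 and 4
    give the two trivial partitions, which an imprimitivity system excludes.\<close>
  then have "card B \<in> {1, 2, 4}"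
  proof -
    have "card B \<le> 4" using \<open>card B dvd 4\<close> by (rule dvd_imp_le) simp
    then have "card B \<in> {0, 1, 2, 3, 4}" by auto
    then show ?thesis using \<open>card B dvd 4\<close> by auto
  qed
  moreover have "card B \<noteq> 1"
  proof
    assume "card B = 1"
    then have single: "\<exists>e. C = {e}" if "C \<in> D" for C
      using card_block_eq[OF that B] by (metis card_1_singletonE)
    have "D = (\<lambda>x. {x}) ` nbhd Y v"
    proof (intro equalityI subsetI)
      fix C assume "C \<in> D"
      then show "C \<in> (\<lambda>x. {x}) ` nbhd Y v" using single sub by fastforce
    next
      fix C assume "C \<in> (\<lambda>x. {x}) ` nbhd Y v"
      then obtain e A where "C = {e}" "A \<in> D" "e \<in> A"
        using partition_onD1[OF partition_D] by auto
      then show "C \<in> D" using single by fastforce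
    qed
    then show False using system by (simp add: imprimitivity_system_def)
  qed
  moreover have "card B \<noteq> 4"
  proof
    assume "card B = 4"
    then have "C = nbhd Y v" if "C \<in> D" for C
      using card_block_eq[OF that B] card_nbhd[OF v] sub[OF that] fin by (simp add: card_subset_eq)
    then have "D = {nbhd Y v}" using B by auto
    then show False using system by (simp add: imprimitivity_system_def)
  qed
  ultimately show ?thesis by simp
qed

section \<open>Translates of the system to all white vertices\<close>

lemma
  assumes w: "w \<in> verts Y" "col Y w = White"
  shows transporter_in: "transporter G v w \<in> G"
    and vact_transporter: "vact (transporter G v w) v = w"
proof -
  obtain e f where "e \<in> nbhd Y v" "f \<in> nbhd Y w" using white_no_isolated v w by blast
  then have ef: "e \<in> edges Y" "f \<in> edges Y" "white_end Y e = v" "white_end Y f = w"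
    using nbhd_white v w by auto
  \<comment> \<open>Moving an edge at \<open>v\<close> to an edge at \<open>w\<close> moves
    \<open>v\<close> to \<open>w\<close>, so \<open>G\<close> is transitive on white vertices and
    the choice in \<open>transporter\<close> has a witness.\<close>
  obtain g where "g \<in> G" "eact g e = f" using edge_transitive ef by blast
  then have "g \<in> G \<and> vact g v = w" using white_end_eact_G ef by metis
  then have "transporter G v w \<in> G \<and> vact (transporter G v w) v = w"
    unfolding transporter_def by (rule someI[of "\<lambda>g. g \<in> G \<and> vact g v = w"])
  then show "transporter G v w \<in> G" "vact (transporter G v w) v = w" by auto
qed

abbreviation blocks :: "'v \<Rightarrow> 'e set set" where
  "blocks w \<equiv> transported_system G v D w"

lemma image_eact_mult:
  assumes "g \<in> G" "h \<in> G" "B \<in> D"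
  shows "eact (g \<otimes>\<^bsub>aut Y\<^esub> h) ` B = eact g ` eact h ` B"
  unfolding image_image using assms(1,2) block_subset[OF assms(3)]
  by (intro image_cong) (auto simp: eact_mult_G)

text \<open>Independence of the chosen transporter: any two of them differ by an element of \<open>G\<^sub>v\<close>.\<close>

lemma eact_block_transported:
  assumes g: "g \<in> G" and B: "B \<in> D"
  shows "eact g ` B \<in> blocks (vact g v)"
proof -
  let ?w = "vact g v" and ?t = "transporter G v (vact g v)"
  have w: "?w \<in> verts Y" "col Y ?w = White" using g v vact_in col_vact by auto
  note t = transporter_in[OF w] vact_transporter[OF w]
  let ?h = "inv\<^bsub>aut Y\<^esub> ?t \<otimes>\<^bsub>aut Y\<^esub> g"
  have h: "?h \<in> G" using mult_G inv_G t g by blast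
  have "vact ?h v = vact (inv\<^bsub>aut Y\<^esub> ?t) (vact ?t v)"
    using vact_mult_G[OF inv_G[OF t(1)] g v(1)] t(2) by simp
  then have "vact ?h v = v" using vact_inv_cancel[OF t(1) v(1)] by simp
  then have "eact ?h ` B \<in> D" using eact_block h B by blast
  moreover have "eact ?t ` eact ?h ` B = eact g ` B"
    unfolding image_image
  proof (rule image_cong)
    fix e assume "e \<in> B"
    then have e: "e \<in> edges Y" using block_subset B by blast
    then show "eact ?t (eact ?h e) = eact g e"
      using eact_mult_G[OF inv_G[OF t(1)] g] eact_inv_cancel[OF t(1)] eact_in[OF g] by simp
  qed simp
  ultimately show ?thesis unfolding transported_system_def by (metis imageI)
qed

text \<open>The product of \<open>g\<close> with the transporter of \<open>w\<close> takes
  \<open>v\<close> to \<open>vact g w\<close>, so \<open>eact_block_transported\<close> applies to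
  it. This gives the invariance of the split under \<open>G\<close>.\<close>

lemma eact_transported:
  assumes g: "g \<in> G" and w: "w \<in> verts Y" "col Y w = White" and C: "C \<in> blocks w"
  shows "eact g ` C \<in> blocks (vact g w)"
proof -
  note t = transporter_in[OF w] vact_transporter[OF w]
  obtain B where B: "B \<in> D" "C = eact (transporter G v w) ` B"
    using C by (auto simp: transported_system_def)
  have "eact g ` C = eact (g \<otimes>\<^bsub>aut Y\<^esub> transporter G v w) ` B"
    using image_eact_mult g t B by simp
  moreover have "vact (g \<otimes>\<^bsub>aut Y\<^esub> transporter G v w) v = vact g w"
    using vact_mult_G[OF g t(1) v(1)] t(2) by simp
  ultimately show ?thesis using eact_block_transported[OF mult_G[OF g t(1)] B(1)] by simp
qed

lemma partition_transported:
  assumes w: "w \<in> verts Y" "col Y w = White"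
  shows "partition_on (nbhd Y w) (blocks w)"
proof -
  let ?t = "transporter G v w"
  note t = transporter_in[OF w] vact_transporter[OF w]
  have sub: "nbhd Y v \<subseteq> edges Y" by (auto simp: nbhd_def)
  then have inj: "inj_on (eact ?t) (nbhd Y v)"
    using inj_on_eact[OF t(1)] by (rule inj_on_subset[rotated])
  \<comment> \<open>Only an inclusion is shown directly; both neighbourhoods have four edges, so an
    injective map between them is onto.\<close>
  have "eact ?t ` nbhd Y v \<subseteq> nbhd Y w"
    using nbhd_white v w white_end_eact_G[OF t(1)] eact_in[OF t(1)] t(2) by auto
  moreover have "card (eact ?t ` nbhd Y v) = card (nbhd Y w)"
    using inj card_nbhd v w by (simp add: card_image)
  moreover have "finite (nbhd Y w)" using card_nbhd[OF w] by (metis card.infinite zero_neq_numeral)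
  ultimately have "eact ?t ` nbhd Y v = nbhd Y w" by (simp add: card_subset_eq)
  \<comment> \<open>The image of a partition is given with a possible empty set removed; blocks are
    nonempty, so nothing is lost.\<close>
  then have "partition_on (nbhd Y w) ((`) (eact ?t) ` D - {{}})"
    using partition_on_inj_image[OF partition_D inj] by simp
  moreover have "{} \<notin> (`) (eact ?t) ` D" using partition_onD3[OF partition_D] by auto
  ultimately show ?thesis by (simp add: transported_system_def)
qed

lemma card_transported:
  assumes w: "w \<in> verts Y" "col Y w = White" and C: "C \<in> blocks w"
  shows "card C = 2"
proof -
  obtain B where B: "B \<in> D" "C = eact (transporter G v w) ` B"
    using C by (auto simp: transported_system_def)
  have "inj_on (eact (transporter G v w)) B"
    using inj_on_eact[OF transporter_in[OF w]] block_subset[OF B(1)] by (auto intro: inj_on_subset)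
  then show ?thesis using B card_block by (simp add: card_image)
qed

lemma transported_white_end:
  assumes w: "w \<in> verts Y" "col Y w = White" and C: "C \<in> blocks w" and e: "e \<in> C"
  shows "e \<in> edges Y" "white_end Y e = w"
proof -
  have "e \<in> nbhd Y w" using partition_onD1[OF partition_transported[OF w]] C e by blast
  then show "e \<in> edges Y" "white_end Y e = w" using nbhd_white w by auto
qed

abbreviation all_blocks :: "'e set set" where
  "all_blocks \<equiv> \<Union>w \<in> {w \<in> verts Y. col Y w = White}. blocks w"

text \<open>Blocks at one white vertex are disjoint by transport, and blocks at different white
  vertices because an edge has only one white end.\<close>

lemma partition_all_blocks: "partition_on (edges Y) all_blocks"
proof (rule partition_onI)
  show "\<Union> all_blocks = edges Y"
  proof (intro equalityI subsetI)
    fix e assume "e \<in> \<Union> all_blocks"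
    then show "e \<in> edges Y" using transported_white_end by blast
  next
    fix e assume e: "e \<in> edges Y"
    have "e \<in> \<Union> (blocks (white_end Y e))"
      using partition_onD1[OF partition_transported[of "white_end Y e"]]
        nbhd_white[of "white_end Y e"] e by auto
    moreover have "white_end Y e \<in> {w \<in> verts Y. col Y w = White}" using e by simp
    ultimately show "e \<in> \<Union> all_blocks" by blast
  qed
  show "{} \<notin> all_blocks" using partition_onD3[OF partition_transported] by auto
  fix B C assume BC: "B \<in> all_blocks" "C \<in> all_blocks" "B \<noteq> C"
  then obtain u w where u: "u \<in> verts Y" "col Y u = White" "B \<in> blocks u"
    and w: "w \<in> verts Y" "col Y w = White" "C \<in> blocks w" by blast
  show "disjnt B C"
  proof (cases "u = w")
    case True
    then show ?thesis
      using partition_onD2[OF partition_transported[OF w(1,2)]] u(3) w(3) BC(3)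
      by (auto simp: disjnt_def dest: disjointD)
  next
    case False
    then show ?thesis
      using transported_white_end(2)[OF u] transported_white_end(2)[OF w]
      unfolding disjnt_def by blast
  qed
qed

text \<open>The relation in \<open>Pairs\<close> is membership in a common block, since every edge
  of a block at \<open>w\<close> has white end \<open>w\<close>. The quotient by the relation of a
  partition returns that partition.\<close>

lemma Pairs_eq: "Pairs Y G v D = all_blocks"
proof -
  have "(e \<in> edges Y \<and> f \<in> edges Y \<and>
      (\<exists>w \<in> verts Y. col Y w = White \<and> w \<in> ends Y e \<and> w \<in> ends Y f \<and>
        (\<exists>B \<in> blocks w. e \<in> B \<and> f \<in> B))) \<longleftrightarrow> (\<exists>B \<in> all_blocks. e \<in> B \<and> f \<in> B)" for e f
  proof
    assume "\<exists>B \<in> all_blocks. e \<in> B \<and> f \<in> B"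
    then obtain w B where w: "w \<in> verts Y" "col Y w = White" and B: "B \<in> blocks w" "e \<in> B" "f \<in> B"
      by blast
    then show "e \<in> edges Y \<and> f \<in> edges Y \<and>
      (\<exists>w \<in> verts Y. col Y w = White \<and> w \<in> ends Y e \<and> w \<in> ends Y f \<and>
        (\<exists>B \<in> blocks w. e \<in> B \<and> f \<in> B))"
      using transported_white_end[OF w B(1)] ends_eq by blast
  qed blast
  then show ?thesis
    using partition_on_eq_quotient[OF partition_all_blocks] by (simp add: Pairs_def)
qed

lemma invariant_split_Pairs: "invariant_split Y (Pairs Y G v D) G"
proof unfold_locales
  show "partition_on (edges Y) (Pairs Y G v D)" using partition_all_blocks Pairs_eq by simp
next
  fix P assume "P \<in> Pairs Y G v D"
  then show "card P = 2" using Pairs_eq card_transported by auto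
next
  fix P e f assume "P \<in> Pairs Y G v D" "e \<in> P" "f \<in> P"
  then show "white_end Y e = white_end Y f" using Pairs_eq transported_white_end by auto
next
  fix g P assume "g \<in> G" "P \<in> Pairs Y G v D"
  then show "eact g ` P \<in> Pairs Y G v D"
    using Pairs_eq eact_transported vact_in col_vact by fastforce
qed (use white_no_isolated in auto)

end

theorem theorem4p4:
  fixes \<Gamma> :: "('v, 'e) cgraph" and G :: "('v + 'e \<Rightarrow> 'v + 'e) set"
    and k :: nat and v :: 'v and \<Delta>v :: "'e set set"
  assumes "is_colored_graph \<Gamma>" and "simple \<Gamma>" and "bi_transitive G \<Gamma>"
    and "\<forall>b \<in> verts \<Gamma>. col \<Gamma> b = Black \<longrightarrow> valency \<Gamma> b = k"
    and "\<forall>w \<in> verts \<Gamma>. col \<Gamma> w = White \<longrightarrow> valency \<Gamma> w = 4"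
    and "v \<in> verts \<Gamma>" and "col \<Gamma> v = White"
    and "imprimitive (local_group \<Gamma> G v) (nbhd \<Gamma> v)"
    and "imprimitivity_system (local_group \<Gamma> G v) (nbhd \<Gamma> v) \<Delta>v"
  shows "(\<exists>(X :: ('v, 'e set) mgraph) M \<phi>. BGCG_representation \<Gamma> G k X M \<phi>) \<and>
    (let \<Delta> = Pairs \<Gamma> G v \<Delta>v in
       BGCG_representation \<Gamma> G k (Dis \<Gamma> \<Delta>) (Mate \<Gamma> \<Delta>) (Dis_action \<Gamma> \<Delta>))"
proof -
  interpret white_block_system \<Gamma> G v \<Delta>v
    using assms by unfold_locales auto
  interpret invariant_split \<Gamma> "Pairs \<Gamma> G v \<Delta>v" G
    by (rule invariant_split_Pairs)
  \<comment> \<open>The existential claim takes the explicit graph, relation and action as its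
    witnesses.\<close>
  show ?thesis using BGCG_representation_Dis[OF assms(4,5)] by (auto simp: Let_def)
qed

end
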